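(* There is an absolute constant $C>0$ such that for every integer $k\geq1$, every $\rho\in(0,1]$, every distance parameter $\varepsilon\in(0,1]$ and every $\delta\in(0,1)$, there exists a public-coin $\rho$-LDP protocol for $(k,\varepsilon,\delta)$-independence testing in which each player sends a single bit, using $n=C\frac{k^2}{\varepsilon^2\rho^2}\log\frac1\delta$ players.
   Context: $[k]=\{1,\dots,k\}$; $d_{TV}(\mathbf{p},\mathbf{q})=\frac12\sum_x|\mathbf{p}(x)-\mathbf{q}(x)|$; $\mathbf{q}_1\otimes\mathbf{q}_2$ is the product distribution on $[k]\times[k]$. A channel $W$ is $\rho$-locally differentially private ($\rho$-LDP) if $W(y\mid x')\leq e^{\rho}W(y\mid x)$ for all outputs $y$ and inputs $x,x'$. Setting: $n$ players, player $i$ holds $X_i$, with $X_1,\dots,X_n$ i.i.d. from an unknown distribution $\mathbf{p}$ on $[k]\times[k]$ with marginals $\mathbf{p}_1,\mathbf{p}_2$. In a public-coin (non-interactive) protocol there are private random variables $U_1,\dots,U_n$ and a shared random variable $V$, all mutually independent and independent of the samples; each player $i$ chooses a $\rho$-LDP channel $W_i$ as a function of $V$ (and possibly $U_i$) and simultaneously sends the message $Y_i$ obtained by passing $X_i$ through $W_i$; the referee observes $(Y_1,\dots,Y_n)$ and $V$ (not the $U_i$) and applies a (possibly randomized) map outputting accept or reject. One bit per player means $Y_i\in\{0,1\}$. The protocol solves $(k,\varepsilon,\delta)$-independence testing if it accepts with probability $>1-\delta$ whenever $\mathbf{p}=\mathbf{p}_1\otimes\mathbf{p}_2$, and rejects with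 probability $>1-\delta$ whenever $\inf_{\mathbf{q}_1,\mathbf{q}_2}d_{TV}(\mathbf{p},\mathbf{q}_1\otimes\mathbf{q}_2)>\varepsilon$. *)

theory Defs
  imports "HOL-Probability.Probability"
begin

definition grid :: "nat \<Rightarrow> (nat \<times> nat) set" where
  "grid k = {1..k} \<times> {1..k}"

definition dTV :: "nat \<Rightarrow> (nat \<times> nat) pmf \<Rightarrow> (nat \<times> nat) pmf \<Rightarrow> real" where
  "dTV k p q = 1 / 2 * (\<Sum>x\<in>grid k. \<bar>pmf p x - pmf q x\<bar>)"

definition LDP :: "real \<Rightarrow> 'x set \<Rightarrow> ('x \<Rightarrow> 'y pmf) \<Rightarrow> bool" where
  "LDP \<rho> A W \<longleftrightarrow> (\<forall>y. \<forall>x\<in>A. \<forall>x'\<in>A. pmf (W x') y \<le> exp \<rho> * pmf (W x) y)"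

text \<open>
  \<open>shared_law\<close> and \<open>private_law i\<close> are the laws of \<open>V\<close> and \<open>U\<^sub>i\<close>; \<open>channel i v u\<close> is the channel
  player \<open>i\<close> uses when \<open>V = v\<close> and \<open>U\<^sub>i = u\<close>; \<open>referee v ys\<close> is the law of the decision,
  \<open>True\<close> meaning accept. The referee has no access to the private randomness.
\<close>

record ('u, 'v, 'y) protocol =
  shared_law :: "'v measure"
  private_law :: "nat \<Rightarrow> 'u measure"
  channel :: "nat \<Rightarrow> 'v \<Rightarrow> 'u \<Rightarrow> nat \<times> nat \<Rightarrow> 'y pmf"
  referee :: "'v \<Rightarrow> (nat \<Rightarrow> 'y) \<Rightarrow> bool pmf"

definition public_coin_LDP_protocol ::
    "nat \<Rightarrow> nat \<Rightarrow> real \<Rightarrow> ('u, 'v, 'y::countable) protocol \<Rightarrow> bool" where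
  "public_coin_LDP_protocol n k \<rho> P \<longleftrightarrow>
     prob_space (shared_law P) \<and>
     (\<forall>i\<in>{1..n}.
        prob_space (private_law P i) \<and>
        (\<forall>x\<in>grid k. \<forall>y. (\<lambda>(v, u). pmf (channel P i v u x) y)
            \<in> borel_measurable (shared_law P \<Otimes>\<^sub>M private_law P i)) \<and>
        (\<forall>v\<in>space (shared_law P). \<forall>u\<in>space (private_law P i). LDP \<rho> (grid k) (channel P i v u))) \<and>
     (\<forall>ys\<in>{1..n} \<rightarrow>\<^sub>E UNIV.
        (\<lambda>v. pmf (referee P v ys) True) \<in> borel_measurable (shared_law P))"

text \<open>
  Law of the decision given \<open>V = v\<close> and \<open>U = u\<close>, when the samples are i.i.d. from \<open>p\<close>.
  Sample and message vectors are functions equal to \<open>undefined\<close> outside \<open>{1..n}\<close>.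
\<close>

definition decision ::
    "nat \<Rightarrow> ('u, 'v, 'y) protocol \<Rightarrow> (nat \<times> nat) pmf \<Rightarrow> 'v \<Rightarrow> (nat \<Rightarrow> 'u) \<Rightarrow> bool pmf" where
  "decision n P p v u =
     bind_pmf (Pi_pmf {1..n} undefined (\<lambda>_. p)) (\<lambda>xs.
     bind_pmf (Pi_pmf {1..n} undefined (\<lambda>i. channel P i v (u i) (xs i))) (\<lambda>ys.
     referee P v ys))"

definition decision_prob ::
    "nat \<Rightarrow> ('u, 'v, 'y) protocol \<Rightarrow> (nat \<times> nat) pmf \<Rightarrow> bool \<Rightarrow> real" where
  "decision_prob n P p b =
     (\<integral>(v, u). pmf (decision n P p v u) b \<partial>(shared_law P \<Otimes>\<^sub>M (\<Pi>\<^sub>M i\<in>{1..n}. private_law P i)))"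

definition solves_independence_testing ::
    "nat \<Rightarrow> nat \<Rightarrow> real \<Rightarrow> real \<Rightarrow> ('u, 'v, 'y) protocol \<Rightarrow> bool" where
  "solves_independence_testing n k \<epsilon> \<delta> P \<longleftrightarrow>
     (\<forall>p. set_pmf p \<subseteq> grid k \<longrightarrow>
        (p = pair_pmf (map_pmf fst p) (map_pmf snd p) \<longrightarrow> decision_prob n P p True > 1 - \<delta>) \<and>
        ((INF (q1, q2)\<in>{q. set_pmf q \<subseteq> {1..k}} \<times> {q. set_pmf q \<subseteq> {1..k}}.
            dTV k p (pair_pmf q1 q2)) > \<epsilon> \<longrightarrow> decision_prob n P p False > 1 - \<delta>))"

end

theory Submission
  imports Defs
begin

text \<open>
  The shared coin draws \<open>m = O(log (1 / \<delta>))\<close> independent pairs \<open>(s, t)\<close> of uniform sign vectors.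
  The covariance of \<open>s(X\<^sub>1)\<close> and \<open>t(X\<^sub>2)\<close> is the bilinear form \<open>\<Sum>i j. s\<^sub>i t\<^sub>j D\<^sub>i\<^sub>j\<close> with
  \<open>D = p - p\<^sub>1 \<otimes> p\<^sub>2\<close>. It vanishes under independence; otherwise its second moment is
  \<open>\<Sum>D\<^sub>i\<^sub>j\<^sup>2 > 4 \<epsilon>\<^sup>2 / k\<^sup>2\<close> and its fourth moment at most 9 times the square of that, so by
  Paley-Zygmund it exceeds \<open>\<epsilon> / k\<close> in absolute value with probability at least \<open>1 / 36\<close>.
  For each pair, three groups of \<open>O(k\<^sup>2 / (\<epsilon>\<^sup>2 \<rho>\<^sup>2))\<close> players send randomized responses for
  \<open>s(X\<^sub>1)\<close>, \<open>t(X\<^sub>2)\<close> and \<open>s(X\<^sub>1) t(X\<^sub>2)\<close>, from which the referee estimates the covariance up to a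
  fraction of \<open>\<epsilon> / k\<close>. The referee rejects if a constant fraction of the estimates is large; all but
  a small fraction of them are accurate, except with probability exponentially small in \<open>m\<close>.
\<close>

section \<open>Moments of random signs\<close>

lemma expectation_pair_pmf_finite:
  fixes f :: "'a \<times> 'b \<Rightarrow> real"
  assumes "finite (set_pmf p)" "finite (set_pmf q)"
  shows "measure_pmf.expectation (pair_pmf p q) f =
    measure_pmf.expectation p (\<lambda>a. measure_pmf.expectation q (\<lambda>b. f (a, b)))"
proof -
  have "measure_pmf.expectation (pair_pmf p q) f =
      (\<Sum>x\<in>set_pmf p \<times> set_pmf q. f x * pmf (pair_pmf p q) x)"
    using assms by (intro integral_measure_pmf_real) auto
  also have "\<dots> = (\<Sum>a\<in>set_pmf p. \<Sum>b\<in>set_pmf q. f (a, b) * pmf (pair_pmf p q) (a, b))"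
    by (simp add: sum.cartesian_product case_prod_unfold)
  also have "\<dots> = (\<Sum>a\<in>set_pmf p. (\<Sum>b\<in>set_pmf q. f (a, b) * pmf q b) * pmf p a)"
    by (simp add: pmf_pair sum_distrib_left sum_distrib_right mult_ac)
  also have "\<dots> = (\<Sum>a\<in>set_pmf p. measure_pmf.expectation q (\<lambda>b. f (a, b)) * pmf p a)"
    using assms by (intro sum.cong refl, subst integral_measure_pmf_real[where A="set_pmf q"]) auto
  also have "\<dots> = measure_pmf.expectation p (\<lambda>a. measure_pmf.expectation q (\<lambda>b. f (a, b)))"
    using assms by (subst integral_measure_pmf_real[where A="set_pmf p"]) auto
  finally show ?thesis .
qed

definition sign_of :: "bool \<Rightarrow> real" where
  "sign_of b = (if b then 1 else -1)"

lemma sign_of_simps [simp]: "sign_of True = 1" "sign_of False = -1" "\<bar>sign_of b\<bar> = 1"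
  by (auto simp: sign_of_def)

text \<open>Fixing the value \<open>False\<close> outside \<open>A\<close> gives finite support for
  finite \<open>A\<close>, so every real function of the signs is integrable.\<close>

definition random_signs :: "'a set \<Rightarrow> ('a \<Rightarrow> bool) pmf" where
  "random_signs A = Pi_pmf A False (\<lambda>_. bernoulli_pmf (1 / 2))"

lemma finite_set_random_signs [simp]:
  assumes "finite A"
  shows "finite (set_pmf (random_signs A))"
proof -
  have "set_pmf (random_signs A) \<subseteq> PiE_dflt A False (\<lambda>_. UNIV)"
    using assms by (auto simp: random_signs_def set_Pi_pmf PiE_dflt_def)
  moreover have "finite (PiE_dflt A False (\<lambda>_. UNIV :: bool set))"
    using assms by (intro finite_PiE_dflt) auto
  ultimately show ?thesis
    by (rule finite_subset)
qed

text \<open>Conditioning on the sign at the new point \<open>x\<close>; this drives the induction in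
  the moment bounds.\<close>

lemma expectation_random_signs_insert:
  fixes f :: "('a \<Rightarrow> bool) \<Rightarrow> real"
  assumes "finite A" "x \<notin> A"
  shows "measure_pmf.expectation (random_signs (insert x A)) f =
    measure_pmf.expectation (random_signs A) (\<lambda>s. (f (s(x := True)) + f (s(x := False))) / 2)"
proof -
  note fin = integrable_measure_pmf_finite[OF finite_set_random_signs[OF assms(1)]]
  have "measure_pmf.expectation (random_signs (insert x A)) f =
      measure_pmf.expectation (pair_pmf (bernoulli_pmf (1 / 2)) (random_signs A)) (\<lambda>z. f ((snd z)(x := fst z)))"
    using assms by (simp add: random_signs_def Pi_pmf_insert case_prod_unfold)
  also have "\<dots> = measure_pmf.expectation (bernoulli_pmf (1 / 2))
      (\<lambda>b. measure_pmf.expectation (random_signs A) (\<lambda>s. f (s(x := b))))"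
    using assms by (subst expectation_pair_pmf_finite) (auto intro: finite_subset[of _ UNIV])
  also have "\<dots> = measure_pmf.expectation (random_signs A) (\<lambda>s. (f (s(x := True)) + f (s(x := False))) / 2)"
    by (subst integral_bernoulli_pmf) (auto simp: fin add_divide_distrib)
  finally show ?thesis .
qed

text \<open>
  Khinchine's inequality, stated for vector-valued sums (coordinates \<open>I\<close>) so that it can be applied
  to both sets of signs of a bilinear form in turn.
\<close>

lemma random_signs_moments:
  fixes D :: "'i \<Rightarrow> 'a \<Rightarrow> real"
  assumes "finite A"
  shows "measure_pmf.expectation (random_signs A) (\<lambda>s. \<Sum>i\<in>I. (\<Sum>j\<in>A. sign_of (s j) * D i j)\<^sup>2) =
      (\<Sum>i\<in>I. \<Sum>j\<in>A. (D i j)\<^sup>2)" (is "?E1 A = ?V A")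
    and "measure_pmf.expectation (random_signs A) (\<lambda>s. (\<Sum>i\<in>I. (\<Sum>j\<in>A. sign_of (s j) * D i j)\<^sup>2)\<^sup>2) \<le>
      3 * (\<Sum>i\<in>I. \<Sum>j\<in>A. (D i j)\<^sup>2)\<^sup>2" (is "?E2 A \<le> _")
proof -
  have "?E1 A = ?V A \<and> ?E2 A \<le> 3 * (?V A)\<^sup>2"
    using assms
  proof (induction A rule: finite_induct)
    case empty
    show ?case by simp
  next
    case (insert x A)
    note fin = integrable_measure_pmf_finite[OF finite_set_random_signs[OF insert.hyps(1)]]
    define N where "N s = (\<Sum>i\<in>I. (\<Sum>j\<in>A. sign_of (s j) * D i j)\<^sup>2)" for s
    define c where "c s = (\<Sum>i\<in>I. (\<Sum>j\<in>A. sign_of (s j) * D i j) * D i x)" for s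
    define d where "d = (\<Sum>i\<in>I. (D i x)\<^sup>2)"
    have N0: "N s \<ge> 0" and d0: "d \<ge> 0" for s
      by (auto simp: N_def d_def sum_nonneg)
    have CS: "(c s)\<^sup>2 \<le> N s * d" for s
      unfolding c_def N_def d_def by (rule Cauchy_Schwarz_ineq_sum)
    \<comment> \<open>Only the cross term depends on the new sign. Averaging over \<open>b\<close>
      cancels it in the first moment and leaves \<open>4 * (c s)\<^sup>2\<close> in the
      second.\<close>
    have upd: "(\<Sum>i\<in>I. (\<Sum>j\<in>insert x A. sign_of ((s(x := b)) j) * D i j)\<^sup>2) =
        N s + 2 * sign_of b * c s + d" for s b
    proof -
      have "(\<Sum>j\<in>insert x A. sign_of ((s(x := b)) j) * D i j) =
          sign_of b * D i x + (\<Sum>j\<in>A. sign_of (s j) * D i j)" for i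
        using insert.hyps by (auto intro!: sum.cong)
      moreover have "sign_of b * sign_of b = 1"
        by (cases b) auto
      ultimately have "(\<Sum>j\<in>insert x A. sign_of ((s(x := b)) j) * D i j)\<^sup>2 =
          (\<Sum>j\<in>A. sign_of (s j) * D i j)\<^sup>2 +
          2 * sign_of b * ((\<Sum>j\<in>A. sign_of (s j) * D i j) * D i x) + (D i x)\<^sup>2" for i
        by (simp add: power2_eq_square algebra_simps)
      then show ?thesis
        by (simp add: N_def c_def d_def sum.distrib sum_distrib_left)
    qed
    have V: "?V (insert x A) = ?V A + d"
      using insert.hyps by (simp add: d_def sum.distrib)
    have IH1: "measure_pmf.expectation (random_signs A) N = ?V A"
      and IH2: "measure_pmf.expectation (random_signs A) (\<lambda>s. (N s)\<^sup>2) \<le> 3 * (?V A)\<^sup>2"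
      using insert.IH by (auto simp: N_def[abs_def])
    have "?E1 (insert x A) = measure_pmf.expectation (random_signs A) (\<lambda>s. N s + d)"
      by (subst expectation_random_signs_insert[OF insert.hyps], subst (1 2) upd,
          intro Bochner_Integration.integral_cong refl) (simp add: field_simps)
    also have "\<dots> = ?V A + d"
      by (simp add: fin IH1)
    finally have E1: "?E1 (insert x A) = ?V (insert x A)"
      using V by simp
    have "?E2 (insert x A) = measure_pmf.expectation (random_signs A) (\<lambda>s. (N s + d)\<^sup>2 + 4 * (c s)\<^sup>2)"
      by (subst expectation_random_signs_insert[OF insert.hyps], subst (1 2) upd,
          intro Bochner_Integration.integral_cong refl) (simp add: power2_eq_square field_simps)
    \<comment> \<open>Cauchy-Schwarz turns \<open>4 * (c s)\<^sup>2\<close> into at most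
      \<open>4 * d * N s\<close>; with the \<open>2 * d * N s\<close> from the square this gives the
      coefficient 6, exactly the cross term of \<open>3 * (?V A + d)\<^sup>2\<close>.\<close>
    also have "\<dots> \<le> measure_pmf.expectation (random_signs A) (\<lambda>s. (N s)\<^sup>2 + (6 * d) * N s + d\<^sup>2)"
    proof (rule integral_mono[OF fin fin])
      show "(N s + d)\<^sup>2 + 4 * (c s)\<^sup>2 \<le> (N s)\<^sup>2 + (6 * d) * N s + d\<^sup>2" for s
        using CS[of s] by (simp add: power2_eq_square algebra_simps)
    qed
    also have "\<dots> = measure_pmf.expectation (random_signs A) (\<lambda>s. (N s)\<^sup>2) + 6 * d * ?V A + d\<^sup>2"
      by (simp add: fin IH1)
    also have "\<dots> \<le> 3 * (?V A + d)\<^sup>2"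
      using IH2 by (simp add: power2_sum algebra_simps add_increasing)
    finally show ?case
      using E1 V by simp
  qed
  then show "?E1 A = ?V A" "?E2 A \<le> 3 * (?V A)\<^sup>2"
    by auto
qed

section \<open>Anticoncentration of bilinear sign forms\<close>

lemma Paley_Zygmund_pmf:
  fixes X :: "'a \<Rightarrow> real"
  assumes fin: "finite (set_pmf p)"
    and nn: "\<And>x. X x \<ge> 0"
    and mean: "measure_pmf.expectation p X = \<mu>" "\<mu> > 0"
    and second: "measure_pmf.expectation p (\<lambda>x. (X x)\<^sup>2) \<le> 9 * \<mu>\<^sup>2"
  shows "measure_pmf.prob p {x. \<mu> / 2 \<le> X x} \<ge> 1 / 36"
proof -
  note int = integrable_measure_pmf_finite[OF fin]
  let ?G = "{x. \<mu> / 2 \<le> X x}"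
  \<comment> \<open>On \<open>?G\<close> this is AM-GM, weighted so that in expectation the
    quadratic term costs at most \<open>\<mu> / 4\<close>. The remaining \<open>\<mu> / 4\<close> of
    the mean must come from \<open>9 * \<mu>\<close> times the probability of
    \<open>?G\<close>.\<close>
  have "X x \<le> \<mu> / 2 + (X x)\<^sup>2 / (36 * \<mu>) + 9 * \<mu> * indicat_real ?G x" for x
  proof (cases "x \<in> ?G")
    case True
    have "0 \<le> (X x - 18 * \<mu>)\<^sup>2 / (36 * \<mu>)"
      using mean by simp
    also have "(X x - 18 * \<mu>)\<^sup>2 / (36 * \<mu>) = (X x)\<^sup>2 / (36 * \<mu>) - X x + 9 * \<mu>"
      using mean by (simp add: power2_eq_square field_simps)
    finally have "X x \<le> (X x)\<^sup>2 / (36 * \<mu>) + 9 * \<mu>"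
      by simp
    then show ?thesis using True mean by simp
  next
    case False
    moreover have "0 \<le> (X x)\<^sup>2 / (36 * \<mu>)"
      using mean by simp
    ultimately show ?thesis by simp
  qed
  then have "measure_pmf.expectation p X \<le>
      measure_pmf.expectation p (\<lambda>x. \<mu> / 2 + (X x)\<^sup>2 / (36 * \<mu>) + 9 * \<mu> * indicat_real ?G x)"
    by (intro integral_mono int)
  also have "\<dots> = \<mu> / 2 + measure_pmf.expectation p (\<lambda>x. (X x)\<^sup>2) / (36 * \<mu>) + 9 * \<mu> * measure_pmf.prob p ?G"
    by (simp add: int)
  also have "\<dots> \<le> \<mu> / 2 + 9 * \<mu>\<^sup>2 / (36 * \<mu>) + 9 * \<mu> * measure_pmf.prob p ?G"
    using second mean by (intro add_mono divide_right_mono) auto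
  also have "9 * \<mu>\<^sup>2 / (36 * \<mu>) = \<mu> / 4"
    using mean by (simp add: power2_eq_square)
  finally have "\<mu> * (1 / 4) \<le> \<mu> * (9 * measure_pmf.prob p ?G)"
    using mean by (simp add: field_simps)
  then have "1 / 4 \<le> 9 * measure_pmf.prob p ?G"
    using mean by (simp only: mult_le_cancel_left_pos)
  then show ?thesis by simp
qed

text \<open>For fixed \<open>t\<close> the form is a sign sum in \<open>s\<close> whose coefficient
  vector is itself a vector-valued sign sum in \<open>t\<close>. Each stage costs a factor 3 in the
  fourth moment, so Paley-Zygmund applies to the square of the form with constant 9.\<close>

lemma random_sign_form_anticoncentration:
  fixes D :: "'a \<Rightarrow> 'b \<Rightarrow> real"
  assumes fin: "finite A" "finite B"
    and pos: "0 < (\<Sum>i\<in>A. \<Sum>j\<in>B. (D i j)\<^sup>2)"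
  shows "measure_pmf.prob (pair_pmf (random_signs A) (random_signs B))
    {(s, t). (\<Sum>i\<in>A. \<Sum>j\<in>B. (D i j)\<^sup>2) / 2 \<le> (\<Sum>i\<in>A. \<Sum>j\<in>B. sign_of (s i) * sign_of (t j) * D i j)\<^sup>2}
    \<ge> 1 / 36"
proof -
  define V where "V = (\<Sum>i\<in>A. \<Sum>j\<in>B. (D i j)\<^sup>2)"
  define a where "a t i = (\<Sum>j\<in>B. sign_of (t j) * D i j)" for t i
  \<comment> \<open>The signs \<open>t\<close> come first so that the iterated expectation
    integrates out \<open>s\<close> on the inside.\<close>
  define Q where "Q = pair_pmf (random_signs B) (random_signs A)"
  note int = integrable_measure_pmf_finite[OF finite_set_random_signs[OF fin(2)]]
  have Z: "(\<Sum>i\<in>A. \<Sum>j\<in>B. sign_of (s i) * sign_of (t j) * D i j) = (\<Sum>i\<in>A. sign_of (s i) * a t i)" for s t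
    by (simp add: a_def sum_distrib_left mult_ac)
  have m2: "measure_pmf.expectation (random_signs A) (\<lambda>s. (\<Sum>i\<in>A. sign_of (s i) * a t i)\<^sup>2) =
      (\<Sum>i\<in>A. (a t i)\<^sup>2)" for t
    \<comment> \<open>A one-point coordinate set reduces the vector-valued moments to the scalar
      ones.\<close>
    using random_signs_moments(1)[OF fin(1), of "\<lambda>_. a t" "{()}"] by simp
  have m4: "measure_pmf.expectation (random_signs A) (\<lambda>s. ((\<Sum>i\<in>A. sign_of (s i) * a t i)\<^sup>2)\<^sup>2) \<le>
      3 * (\<Sum>i\<in>A. (a t i)\<^sup>2)\<^sup>2" for t
    using random_signs_moments(2)[OF fin(1), of "\<lambda>_. a t" "{()}"] by simp
  have M2: "measure_pmf.expectation (random_signs B) (\<lambda>t. \<Sum>i\<in>A. (a t i)\<^sup>2) = V"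
    unfolding a_def V_def by (rule random_signs_moments(1)[OF fin(2)])
  have M4: "measure_pmf.expectation (random_signs B) (\<lambda>t. (\<Sum>i\<in>A. (a t i)\<^sup>2)\<^sup>2) \<le> 3 * V\<^sup>2"
    unfolding a_def V_def by (rule random_signs_moments(2)[OF fin(2)])
  have "1 / 36 \<le> measure_pmf.prob Q {z. V / 2 \<le> (\<Sum>i\<in>A. sign_of (snd z i) * a (fst z) i)\<^sup>2}"
  proof (rule Paley_Zygmund_pmf)
    show "finite (set_pmf Q)"
      using fin by (simp add: Q_def)
    show "measure_pmf.expectation Q (\<lambda>z. (\<Sum>i\<in>A. sign_of (snd z i) * a (fst z) i)\<^sup>2) = V"
      unfolding Q_def using fin by (subst expectation_pair_pmf_finite) (simp_all add: m2 M2)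
    have "measure_pmf.expectation Q (\<lambda>z. ((\<Sum>i\<in>A. sign_of (snd z i) * a (fst z) i)\<^sup>2)\<^sup>2) =
        measure_pmf.expectation (random_signs B) (\<lambda>t. measure_pmf.expectation (random_signs A)
          (\<lambda>s. ((\<Sum>i\<in>A. sign_of (s i) * a t i)\<^sup>2)\<^sup>2))"
      unfolding Q_def using fin by (subst expectation_pair_pmf_finite) simp_all
    also have "\<dots> \<le> measure_pmf.expectation (random_signs B) (\<lambda>t. 3 * (\<Sum>i\<in>A. (a t i)\<^sup>2)\<^sup>2)"
      by (intro integral_mono int m4)
    also have "\<dots> \<le> 9 * V\<^sup>2"
      using M4 by simp
    finally show "measure_pmf.expectation Q (\<lambda>z. ((\<Sum>i\<in>A. sign_of (snd z i) * a (fst z) i)\<^sup>2)\<^sup>2) \<le> 9 * V\<^sup>2" .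
  qed (use pos in \<open>auto simp: V_def\<close>)
  also have "\<dots> = measure_pmf.prob (map_pmf (\<lambda>(x, y). (y, x)) Q)
      {(s, t). V / 2 \<le> (\<Sum>i\<in>A. sign_of (s i) * a t i)\<^sup>2}"
    by (simp add: vimage_def case_prod_unfold)
  also have "map_pmf (\<lambda>(x, y). (y, x)) Q = pair_pmf (random_signs A) (random_signs B)"
    unfolding Q_def by (subst pair_commute_pmf[symmetric]) simp
  finally show ?thesis
    by (simp add: V_def Z)
qed

section \<open>Concentration under product distributions\<close>

text \<open>Coordinates of a product are independent and each summand lies in an interval of length
  2, so Hoeffding's exponent is \<open>2 * t\<^sup>2 / (4 * card I)\<close>.\<close>

lemma Hoeffding_Pi_pmf:
  fixes f :: "'i \<Rightarrow> 'a \<Rightarrow> real"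
  assumes J: "finite J" "I \<subseteq> J" "I \<noteq> {}"
    and bd: "\<And>i y. i \<in> I \<Longrightarrow> \<bar>f i y\<bar> \<le> 1"
    and mean: "\<And>i. i \<in> I \<Longrightarrow> measure_pmf.expectation (q i) (f i) = 0"
    and t: "t \<ge> 0"
  shows "measure_pmf.prob (Pi_pmf J d q) {y. t \<le> (\<Sum>i\<in>I. f i (y i))} \<le> exp (- (t\<^sup>2 / (2 * real (card I))))"
proof -
  let ?M = "measure_pmf (Pi_pmf J d q)"
  have finI: "finite I" using J finite_subset by blast
  have "prob_space.indep_vars ?M (\<lambda>_. borel) (\<lambda>i y. f i (y i)) J"
    using prob_space.indep_vars_compose2[OF measure_pmf.prob_space_axioms indep_vars_Pi_pmf[OF J(1)], of f "\<lambda>_. borel"]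
    by simp
  then have ind: "prob_space.indep_vars ?M (\<lambda>_. borel) (\<lambda>i y. f i (y i)) I"
    using prob_space.indep_vars_subset[OF measure_pmf.prob_space_axioms] J by blast
  interpret H: Hoeffding_ineq ?M I "\<lambda>i y. f i (y i)" "\<lambda>_. -1" "\<lambda>_. 1"
    "\<Sum>i\<in>I. measure_pmf.expectation (Pi_pmf J d q) (\<lambda>y. f i (y i))"
    by unfold_locales (use ind finI bd in \<open>auto simp: abs_le_iff minus_le_iff\<close>)
  have E: "measure_pmf.expectation (Pi_pmf J d q) (\<lambda>y. f i (y i)) = 0" if "i \<in> I" for i
  proof -
    have "measure_pmf.expectation (Pi_pmf J d q) (\<lambda>y. f i (y i)) =
        measure_pmf.expectation (map_pmf (\<lambda>y. y i) (Pi_pmf J d q)) (f i)"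
      by simp
    also have "map_pmf (\<lambda>y. y i) (Pi_pmf J d q) = q i"
      using that J by (subst Pi_pmf_component) auto
    finally show ?thesis using mean[OF that] by simp
  qed
  have "card I > 0" using finI J by (simp add: card_gt_0_iff)
  then show ?thesis
    using H.Hoeffding_ineq_ge[OF t] by (simp add: E)
qed

text \<open>
  If many group sums are large in absolute value, then some \<open>{-1, 0, 1}\<close>-valued weighting of the
  groups makes the whole weighted sum large; a union bound over the weightings replaces an
  argument about the independence of the groups.
\<close>

lemma many_large_group_sums_Pi_pmf:
  fixes f :: "'i \<Rightarrow> 'a \<Rightarrow> real"
  assumes J: "finite J" "I \<subseteq> J" "I \<noteq> {}"
    and G: "finite G" "grp ` I \<subseteq> G"
    and bd: "\<And>i y. i \<in> I \<Longrightarrow> \<bar>f i y\<bar> \<le> 1"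
    and mean: "\<And>i. i \<in> I \<Longrightarrow> measure_pmf.expectation (q i) (f i) = 0"
    and t: "t \<ge> 0" and b: "b \<ge> 0"
  shows "measure_pmf.prob (Pi_pmf J d q)
      {y. b \<le> real (card {a\<in>G. t \<le> \<bar>\<Sum>i | i \<in> I \<and> grp i = a. f i (y i)\<bar>})}
    \<le> 3 ^ card G * exp (- ((b * t)\<^sup>2 / (2 * real (card I))))" (is "measure_pmf.prob ?M ?E \<le> _")
proof -
  define S where "S = PiE G (\<lambda>_. {-1, 0, 1 :: real})"
  define T where "T s = {y. b * t \<le> (\<Sum>i\<in>I. s (grp i) * f i (y i))}" for s :: "'b \<Rightarrow> real"
  have finI: "finite I" using J finite_subset by blast
  have finS: "finite S" unfolding S_def using G by (intro finite_PiE) auto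
  have cardS: "card S = 3 ^ card G"
    unfolding S_def using G by (subst card_PiE) (auto simp: numeral_eq_Suc)
  have "?E \<subseteq> (\<Union>s\<in>S. T s)"
  proof
    fix y assume y: "y \<in> ?E"
    define e where "e a = (\<Sum>i | i \<in> I \<and> grp i = a. f i (y i))" for a
    define L where "L = {a\<in>G. t \<le> \<bar>e a\<bar>}"
    define s where "s = restrict (\<lambda>a. if a \<in> L then if e a \<ge> 0 then 1 else -1 else 0 :: real) G"
    have "b * t \<le> real (card L) * t"
      using y t by (intro mult_right_mono) (auto simp: L_def e_def)
    also have "\<dots> = (\<Sum>a\<in>G. if a \<in> L then t else 0)"
      using G by (subst sum.If_cases) (auto simp: L_def Int_def)
    also have "\<dots> \<le> (\<Sum>a\<in>G. s a * e a)"
      by (intro sum_mono) (auto simp: s_def L_def)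
    also have "\<dots> = (\<Sum>a\<in>G. \<Sum>i | i \<in> I \<and> grp i = a. s (grp i) * f i (y i))"
      unfolding e_def by (simp add: sum_distrib_left)
    also have "\<dots> = (\<Sum>i\<in>I. s (grp i) * f i (y i))"
      using finI G by (rule sum.group)
    finally have "y \<in> T s" by (simp add: T_def)
    moreover have "s \<in> S" by (auto simp: s_def S_def)
    ultimately show "y \<in> (\<Union>s\<in>S. T s)" by blast
  qed
  then have "measure_pmf.prob ?M ?E \<le> measure_pmf.prob ?M (\<Union>s\<in>S. T s)"
    by (intro measure_pmf.finite_measure_mono) auto
  also have "\<dots> \<le> (\<Sum>s\<in>S. measure_pmf.prob ?M (T s))"
    using finS by (intro measure_pmf.finite_measure_subadditive_finite) auto
  also have "\<dots> \<le> (\<Sum>s\<in>S. exp (- ((b * t)\<^sup>2 / (2 * real (card I)))))"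
  proof (rule sum_mono)
    fix s assume s: "s \<in> S"
    \<comment> \<open>Weights of modulus at most 1 keep the summands centred and within
      \<open>[-1, 1]\<close>, so Hoeffding's bound is the same for every weighting.\<close>
    have s1: "\<bar>s (grp i)\<bar> \<le> 1" if "i \<in> I" for i
    proof -
      have "grp i \<in> G" using that G by blast
      then show ?thesis using PiE_mem[OF s[unfolded S_def]] by fastforce
    qed
    have "\<bar>s (grp i) * f i y\<bar> \<le> 1" if "i \<in> I" for i y
      using mult_mono[OF s1[OF that] bd[OF that, of y]] by (simp add: abs_mult)
    then show "measure_pmf.prob ?M (T s) \<le> exp (- ((b * t)\<^sup>2 / (2 * real (card I))))"
      unfolding T_def using mean b t by (intro Hoeffding_Pi_pmf[OF J]) auto
  qed
  also have "\<dots> = 3 ^ card G * exp (- ((b * t)\<^sup>2 / (2 * real (card I))))"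
    by (simp add: cardS)
  finally show ?thesis .
qed

section \<open>Groups of players and the shared coin\<close>

text \<open>The groups are the fibres of the first component of a bijection from \<open>I\<close>
  onto \<open>G \<times> {..<g}\<close>. Players beyond \<open>card G * g\<close> stay outside
  \<open>I\<close>, which absorbs the rounding of \<open>n\<close>.\<close>

lemma ex_grouping:
  assumes "finite G" "card G * g \<le> n"
  obtains I :: "nat set" and grp :: "nat \<Rightarrow> 'a" where
    "I \<subseteq> {1..n}" "grp ` I \<subseteq> G" "card I = card G * g"
    "\<And>a. a \<in> G \<Longrightarrow> card {i. i \<in> I \<and> grp i = a} = g"
proof -
  define I where "I = {1..card G * g}"
  have "card I = card (G \<times> {..<g})"
    by (simp add: I_def card_cartesian_product)
  then obtain h where h: "bij_betw h I (G \<times> {..<g})"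
    using assms finite_same_card_bij[of I "G \<times> {..<g}"] by (auto simp: I_def)
  show ?thesis
  proof (rule that[of I "\<lambda>i. fst (h i)"])
    show "I \<subseteq> {1..n}" "card I = card G * g"
      using assms by (auto simp: I_def)
    show "(\<lambda>i. fst (h i)) ` I \<subseteq> G"
      using bij_betwE[OF h] by (auto simp: mem_Times_iff)
    fix a assume a: "a \<in> G"
    have "h ` {i. i \<in> I \<and> fst (h i) = a} = {a} \<times> {..<g}"
    proof (intro equalityI subsetI)
      fix z assume z: "z \<in> {a} \<times> {..<g}"
      with a h obtain i where "i \<in> I" "h i = z"
        unfolding bij_betw_def by (metis (no_types, lifting) SigmaE SigmaI image_iff singletonD)
      with z show "z \<in> h ` {i. i \<in> I \<and> fst (h i) = a}" by force
    qed (use bij_betwE[OF h] in \<open>auto simp: mem_Times_iff\<close>)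
    then have "bij_betw h {i. i \<in> I \<and> fst (h i) = a} ({a} \<times> {..<g})"
      using h by (auto simp: bij_betw_def intro: inj_on_subset)
    then show "card {i. i \<in> I \<and> fst (h i) = a} = g"
      using bij_betw_same_card by fastforce
  qed
qed

text \<open>
  Private randomness is left trivial, and an arbitrary discrete shared coin is encoded in the reals
  by enumerating its support.
\<close>

lemma obtain_shared_coin_protocol:
  fixes Q :: "'w pmf" and ch :: "nat \<Rightarrow> 'w \<Rightarrow> nat \<times> nat \<Rightarrow> bool pmf"
    and ref :: "'w \<Rightarrow> (nat \<Rightarrow> bool) \<Rightarrow> bool pmf"
  assumes ldp: "\<And>i w. LDP \<rho> (grid k) (ch i w)"
  obtains P :: "(real, real, bool) protocol" where
    "public_coin_LDP_protocol n k \<rho> P"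
    "\<And>p b. decision_prob n P p b =
       pmf (Q \<bind> (\<lambda>w. Pi_pmf {1..n} undefined (\<lambda>i. p \<bind> ch i w) \<bind> ref w)) b"
proof -
  define enc where "enc w = real (to_nat_on (set_pmf Q) w)" for w
  define dec where "dec v = from_nat_into (set_pmf Q) (nat \<lfloor>v\<rfloor>)" for v :: real
  have dec_enc: "dec (enc w) = w" if "w \<in> set_pmf Q" for w
    using that by (simp add: dec_def enc_def countable_set_pmf)
  define P :: "(real, real, bool) protocol" where
    "P = \<lparr>shared_law = measure_pmf (map_pmf enc Q), private_law = (\<lambda>_. measure_pmf (return_pmf 0)),
          channel = (\<lambda>i v u. ch i (dec v)), referee = (\<lambda>v. ref (dec v))\<rparr>"
  have "public_coin_LDP_protocol n k \<rho> P"
    unfolding public_coin_LDP_protocol_def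
  proof (intro conjI ballI allI)
    fix i x y
    have "(\<lambda>v. pmf (ch i (dec v) x) y) \<in> borel_measurable (measure_pmf (map_pmf enc Q))"
      by simp
    from measurable_compose[OF measurable_fst this]
    show "(\<lambda>(v, u). pmf (channel P i v u x) y) \<in> borel_measurable (shared_law P \<Otimes>\<^sub>M private_law P i)"
      by (simp add: P_def case_prod_unfold)
  qed (auto simp: P_def ldp intro: measure_pmf.prob_space_axioms)
  moreover have "decision_prob n P p b =
       pmf (Q \<bind> (\<lambda>w. Pi_pmf {1..n} undefined (\<lambda>i. p \<bind> ch i w) \<bind> ref w)) b" for p b
  proof -
    define F where "F w = pmf (Pi_pmf {1..n} undefined (\<lambda>i. p \<bind> ch i w) \<bind> ref w) b" for w
    let ?M = "measure_pmf (map_pmf enc Q)" and ?N = "\<Pi>\<^sub>M i\<in>{1..n}. measure_pmf (return_pmf (0::real))"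
    \<comment> \<open>Drawing all samples and then all messages amounts to drawing each message from
      its own mixture over \<open>p\<close>. The default \<open>d'\<close> must be that of the
      sample vector in \<open>decision\<close>.\<close>
    have dec: "pmf (decision n P p v u) b = F (dec v)" for v u
      unfolding F_def decision_def P_def
      by (subst Pi_pmf_bind[where d' = undefined]) (auto simp: bind_assoc_pmf)
    interpret N: prob_space ?N
      by (intro prob_space_PiM measure_pmf.prob_space_axioms)
    have "decision_prob n P p b = (\<integral>z. F (dec (fst z)) \<partial>(?M \<Otimes>\<^sub>M ?N))"
      unfolding decision_prob_def by (simp add: dec case_prod_unfold) (simp add: P_def)
    also have "\<dots> = (\<integral>v. F (dec v) \<partial>distr (?M \<Otimes>\<^sub>M ?N) ?M fst)"
      by (rule integral_distr[symmetric]) auto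
    also have "\<dots> = (\<integral>v. F (dec v) \<partial>?M)"
      by (simp only: N.distr_pair_fst)
    also have "\<dots> = (\<integral>w. F (dec (enc w)) \<partial>Q)"
      by simp
    \<comment> \<open>Decoding inverts encoding only on the support of \<open>Q\<close>, hence
      almost surely.\<close>
    also have "\<dots> = (\<integral>w. F w \<partial>Q)"
      by (intro integral_cong_AE) (auto simp: AE_measure_pmf_iff dec_enc)
    finally show ?thesis
      by (simp add: F_def pmf_bind)
  qed
  ultimately show ?thesis by (rule that)
qed

section \<open>Randomized response and accuracy of the estimates\<close>

text \<open>Randomized response for a value in \<open>[-1, 1]\<close>; the value 0, assigned to
  players without a group, gives a fair coin.\<close>

definition noisy_bit :: "real \<Rightarrow> real \<Rightarrow> bool pmf" where
  "noisy_bit \<rho> s = bernoulli_pmf (1 / 2 + \<rho> / 8 * s)"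

lemma pmf_noisy_bit:
  assumes "0 < \<rho>" "\<rho> \<le> 1" "\<bar>s\<bar> \<le> 1"
  shows "pmf (noisy_bit \<rho> s) b = 1 / 2 + (if b then \<rho> / 8 * s else - (\<rho> / 8 * s))"
proof -
  have "\<bar>\<rho> / 8 * s\<bar> \<le> 1 / 8 * 1"
    using assms unfolding abs_mult by (intro mult_mono) auto
  then show ?thesis
    by (cases b) (auto simp: noisy_bit_def)
qed

text \<open>All probabilities lie within \<open>\<rho> / 8\<close> of \<open>1 / 2\<close>. For
  \<open>\<rho> \<le> 1\<close> the ratio of the two extremes is at most \<open>1 + \<rho>\<close>,
  hence at most \<open>exp \<rho>\<close>.\<close>

lemma LDP_noisy_bit:
  assumes "0 < \<rho>" "\<rho> \<le> 1" "\<And>x. \<bar>s x\<bar> \<le> 1"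
  shows "LDP \<rho> A (\<lambda>x. noisy_bit \<rho> (s x))"
  unfolding LDP_def
proof (intro allI ballI)
  fix y x x'
  have lin: "\<bar>\<rho> / 8 * s z\<bar> \<le> \<rho> / 8" for z
    using assms mult_left_mono[OF assms(3)[of z], of "\<rho> / 8"] by (simp add: abs_mult)
  have "pmf (noisy_bit \<rho> (s x')) y \<le> 1 / 2 + \<rho> / 8"
    using lin[of x'] unfolding pmf_noisy_bit[OF assms]
    by (cases y; simp only: if_True if_False; linarith)
  also have "\<dots> \<le> (1 + \<rho>) * (1 / 2 - \<rho> / 8)"
  proof -
    have "\<rho> * \<rho> \<le> \<rho>"
      using assms by (simp add: mult_left_le)
    moreover have "(1 + \<rho>) * (1 / 2 - \<rho> / 8) = 1 / 2 + 3 / 8 * \<rho> - \<rho> * \<rho> / 8"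
      by (simp add: field_simps)
    ultimately show ?thesis
      using assms by linarith
  qed
  also have "\<dots> \<le> exp \<rho> * pmf (noisy_bit \<rho> (s x)) y"
  proof (intro mult_mono)
    show "1 / 2 - \<rho> / 8 \<le> pmf (noisy_bit \<rho> (s x)) y"
      using lin[of x] unfolding pmf_noisy_bit[OF assms]
      by (cases y; simp only: if_True if_False; linarith)
  qed (use assms in auto)
  finally show "pmf (noisy_bit \<rho> (s x')) y \<le> exp \<rho> * pmf (noisy_bit \<rho> (s x)) y" .
qed

lemma integrable_pmf_bounded:
  fixes f :: "'a \<Rightarrow> real"
  assumes "\<And>x. \<bar>f x\<bar> \<le> 1"
  shows "integrable (measure_pmf p) f"
  using assms by (intro measure_pmf.integrable_const_bound[where B = 1]) auto

lemma integrable_indicator_pmf [simp]: "integrable (measure_pmf p) (indicat_real S)"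
  by (intro integrable_pmf_bounded) auto

lemma expectation_pmf_abs_le_1:
  fixes f :: "'a \<Rightarrow> real"
  assumes "\<And>x. \<bar>f x\<bar> \<le> 1"
  shows "\<bar>measure_pmf.expectation p f\<bar> \<le> 1"
proof -
  have f: "f x \<le> 1" "-1 \<le> f x" for x
    using assms[of x] by auto
  have "measure_pmf.expectation p f \<le> 1"
    using f by (intro measure_pmf.integral_le_const integrable_pmf_bounded assms) auto
  moreover have "-1 \<le> measure_pmf.expectation p f"
    using f by (intro measure_pmf.integral_ge_const integrable_pmf_bounded assms) auto
  ultimately show ?thesis by auto
qed

text \<open>A bit minus \<open>1 / 2\<close> has mean \<open>\<rho> / 8\<close> times the mean of
  the score, so the factor \<open>8 / \<rho>\<close> makes the group average unbiased.\<close>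

definition estimate :: "real \<Rightarrow> nat \<Rightarrow> nat set \<Rightarrow> (nat \<Rightarrow> 'a) \<Rightarrow> (nat \<Rightarrow> bool) \<Rightarrow> 'a \<Rightarrow> real" where
  "estimate \<rho> g I grp ys a =
     8 / (\<rho> * real g) * (\<Sum>i | i \<in> I \<and> grp i = a. of_bool (ys i) - 1 / 2)"

text \<open>An error of \<open>\<eta>\<close> in a group means a centred bit sum of size
  \<open>real g * \<rho> * \<eta> / 8\<close>. Counting bad groups, rather than excluding all of
  them, lets \<open>g\<close> be chosen independently of the number of groups.\<close>

lemma many_inaccurate_estimates:
  fixes p :: "'x pmf" and s :: "'a \<Rightarrow> 'x \<Rightarrow> real"
  assumes I: "I \<subseteq> {1..n}" "I \<noteq> {}" and G: "finite G" "grp ` I \<subseteq> G"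
    and g: "\<And>a. a \<in> G \<Longrightarrow> card {i. i \<in> I \<and> grp i = a} = g" "g > 0"
    and s: "\<And>a x. \<bar>s a x\<bar> \<le> 1"
    and \<rho>: "0 < \<rho>" "\<rho> \<le> 1" and "0 \<le> b" "0 \<le> \<eta>"
  shows "measure_pmf.prob
      (Pi_pmf {1..n} undefined (\<lambda>i. p \<bind> (\<lambda>x. noisy_bit \<rho> (if i \<in> I then s (grp i) x else 0))))
      {ys. b \<le> real (card {a\<in>G. \<eta> \<le> \<bar>estimate \<rho> g I grp ys a - measure_pmf.expectation p (s a)\<bar>})}
    \<le> 3 ^ card G * exp (- ((b * (real g * \<rho> * \<eta> / 8))\<^sup>2 / (2 * real (card I))))"
proof -
  define q where "q i = p \<bind> (\<lambda>x. noisy_bit \<rho> (if i \<in> I then s (grp i) x else 0))" for i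
  define \<mu> where "\<mu> a = measure_pmf.expectation p (s a)" for a
  define f where "f i y = of_bool y - pmf (q i) True" for i y
  have finI: "finite I" using I finite_subset by blast
  have qT: "pmf (q i) True = 1 / 2 + \<rho> / 8 * \<mu> (grp i)" if "i \<in> I" for i
    using that \<rho> s by (simp add: q_def pmf_bind pmf_noisy_bit \<mu>_def integrable_pmf_bounded)
  have f1: "\<bar>f i y\<bar> \<le> 1" for i y
    using pmf_nonneg[of "q i" True] pmf_le_1[of "q i" True] by (auto simp: f_def)
  have f0: "measure_pmf.expectation (q i) (f i) = 0" for i
    by (subst integral_measure_pmf_real[where A = UNIV])
       (auto simp: f_def UNIV_bool pmf_False_conv_True algebra_simps)
  have err: "estimate \<rho> g I grp ys a - \<mu> a =
      8 / (\<rho> * real g) * (\<Sum>i | i \<in> I \<and> grp i = a. f i (ys i))" if "a \<in> G" for ys a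
  proof -
    have "(\<Sum>i | i \<in> I \<and> grp i = a. f i (ys i)) =
        (\<Sum>i | i \<in> I \<and> grp i = a. (of_bool (ys i) - 1 / 2) - \<rho> / 8 * \<mu> a)"
      by (intro sum.cong refl) (auto simp: f_def qT)
    also have "\<dots> = (\<Sum>i | i \<in> I \<and> grp i = a. of_bool (ys i) - 1 / 2) - real g * (\<rho> / 8 * \<mu> a)"
      by (simp add: sum_subtractf g(1)[OF that])
    finally show ?thesis
      using \<rho> g by (simp add: estimate_def field_simps)
  qed
  have "\<eta> \<le> \<bar>estimate \<rho> g I grp ys a - \<mu> a\<bar> \<longleftrightarrow>
      real g * \<rho> * \<eta> / 8 \<le> \<bar>\<Sum>i | i \<in> I \<and> grp i = a. f i (ys i)\<bar>" if "a \<in> G" for ys a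
    using \<rho> g by (simp add: err[OF that] abs_mult field_simps)
  then have eq: "{a\<in>G. \<eta> \<le> \<bar>estimate \<rho> g I grp ys a - \<mu> a\<bar>} =
      {a\<in>G. real g * \<rho> * \<eta> / 8 \<le> \<bar>\<Sum>i | i \<in> I \<and> grp i = a. f i (ys i)\<bar>}" for ys
    by auto
  show ?thesis
    unfolding q_def[symmetric] \<mu>_def[symmetric] eq
    using \<rho> assms by (intro many_large_group_sums_Pi_pmf I G f1 f0) auto
qed

text \<open>Telescoping the product leaves three errors with factors 1,
  \<open>\<bar>a'\<bar> \<le> 2\<close> and \<open>\<bar>b\<bar> \<le> 1\<close>.\<close>

lemma product_estimate_error:
  fixes a b c a' b' c' \<eta> :: real
  assumes "\<bar>a' - a\<bar> < \<eta>" "\<bar>b' - b\<bar> < \<eta>" "\<bar>c' - c\<bar> < \<eta>" "\<bar>a\<bar> \<le> 1" "\<bar>b\<bar> \<le> 1" "\<eta> \<le> 1"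
  shows "\<bar>(c' - a' * b') - (c - a * b)\<bar> \<le> 4 * \<eta>"
proof -
  have "(c' - a' * b') - (c - a * b) = (c' - c) - a' * (b' - b) - b * (a' - a)"
    by (simp add: algebra_simps)
  moreover have "\<bar>a' * (b' - b)\<bar> \<le> 2 * \<eta>"
    unfolding abs_mult using assms by (intro mult_mono) auto
  moreover have "\<bar>b * (a' - a)\<bar> \<le> 1 * \<eta>"
    unfolding abs_mult using assms by (intro mult_mono) auto
  ultimately show ?thesis
    using assms by linarith
qed

section \<open>Sign covariance as a witness of dependence\<close>

definition sign_covariance :: "('a \<times> 'b) pmf \<Rightarrow> ('a \<Rightarrow> bool) \<Rightarrow> ('b \<Rightarrow> bool) \<Rightarrow> real" where
  "sign_covariance p s t =
     measure_pmf.expectation p (\<lambda>x. sign_of (s (fst x)) * sign_of (t (snd x))) -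
     measure_pmf.expectation p (\<lambda>x. sign_of (s (fst x))) *
     measure_pmf.expectation p (\<lambda>x. sign_of (t (snd x)))"

text \<open>The product of the two means is a mean under the product of the marginals; this makes
  the covariance linear in \<open>p - p\<^sub>1 \<otimes> p\<^sub>2\<close>.\<close>

lemma sign_covariance_eq:
  assumes "finite (set_pmf p)"
  shows "sign_covariance p s t =
     measure_pmf.expectation p (\<lambda>x. sign_of (s (fst x)) * sign_of (t (snd x))) -
     measure_pmf.expectation (pair_pmf (map_pmf fst p) (map_pmf snd p))
       (\<lambda>x. sign_of (s (fst x)) * sign_of (t (snd x)))"
  using assms unfolding sign_covariance_def
  by (subst expectation_pair_pmf_finite) simp_all

lemma sign_covariance_detects_dependence:
  assumes p: "set_pmf p \<subseteq> grid k" and k: "k \<ge> 1" and \<epsilon>: "\<epsilon> > 0"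
    and far: "dTV k p (pair_pmf (map_pmf fst p) (map_pmf snd p)) > \<epsilon>"
  shows "measure_pmf.prob (pair_pmf (random_signs {1..k}) (random_signs {1..k}))
    {(s, t). \<epsilon> / real k < \<bar>sign_covariance p s t\<bar>} \<ge> 1 / 36"
proof -
  define q where "q = pair_pmf (map_pmf fst p) (map_pmf snd p)"
  define D where "D i j = pmf p (i, j) - pmf q (i, j)" for i j
  define V where "V = (\<Sum>i\<in>{1..k}. \<Sum>j\<in>{1..k}. (D i j)\<^sup>2)"
  have fing: "finite (grid k)" by (simp add: grid_def)
  have q: "set_pmf q \<subseteq> grid k"
    using p by (force simp: q_def grid_def)
  have cov: "sign_covariance p s t = (\<Sum>i\<in>{1..k}. \<Sum>j\<in>{1..k}. sign_of (s i) * sign_of (t j) * D i j)" for s t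
  proof -
    have "sign_covariance p s t =
        (\<Sum>x\<in>grid k. sign_of (s (fst x)) * sign_of (t (snd x)) * pmf p x) -
        (\<Sum>x\<in>grid k. sign_of (s (fst x)) * sign_of (t (snd x)) * pmf q x)"
      unfolding sign_covariance_eq[OF finite_subset[OF p fing]] q_def[symmetric] using p q fing
      by (subst (1 2) integral_measure_pmf_real[where A = "grid k"]) auto
    also have "\<dots> = (\<Sum>x\<in>grid k. sign_of (s (fst x)) * sign_of (t (snd x)) * D (fst x) (snd x))"
      by (simp add: sum_subtractf[symmetric] D_def algebra_simps)
    finally show ?thesis
      by (simp add: grid_def sum.cartesian_product case_prod_unfold)
  qed
  \<comment> \<open>The factor \<open>1 / 2\<close> in \<open>dTV\<close> makes the L1 norm of
    \<open>D\<close> exceed \<open>2 * \<epsilon>\<close>; Cauchy-Schwarz over the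
    \<open>k\<^sup>2\<close> cells passes to the L2 norm.\<close>
  have "(2 * \<epsilon>)\<^sup>2 < (\<Sum>x\<in>grid k. \<bar>D (fst x) (snd x)\<bar> * 1)\<^sup>2"
    using far \<epsilon> by (intro power_strict_mono) (auto simp: dTV_def D_def q_def)
  also have "\<dots> \<le> (\<Sum>x\<in>grid k. \<bar>D (fst x) (snd x)\<bar>\<^sup>2) * (\<Sum>x\<in>grid k. 1\<^sup>2)"
    by (rule Cauchy_Schwarz_ineq_sum)
  also have "\<dots> = V * (real k)\<^sup>2"
    by (simp add: V_def grid_def sum.cartesian_product case_prod_unfold power2_eq_square)
  finally have V: "2 * (\<epsilon> / real k)\<^sup>2 < V / 2"
    using k by (simp add: power2_eq_square field_simps)
  have "(\<epsilon> / real k)\<^sup>2 \<ge> 0" by simp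
  with V have Vpos: "V > 0" by linarith
  have "1 / 36 \<le> measure_pmf.prob (pair_pmf (random_signs {1..k}) (random_signs {1..k}))
    {(s, t). V / 2 \<le> (sign_covariance p s t)\<^sup>2}"
    unfolding cov V_def using Vpos unfolding V_def by (intro random_sign_form_anticoncentration) auto
  also have "\<dots> \<le> measure_pmf.prob (pair_pmf (random_signs {1..k}) (random_signs {1..k}))
    {(s, t). \<epsilon> / real k < \<bar>sign_covariance p s t\<bar>}"
  proof (intro measure_pmf.finite_measure_mono subsetI)
    fix z assume "z \<in> {(s, t). V / 2 \<le> (sign_covariance p s t)\<^sup>2}"
    then obtain s t where z: "z = (s, t)" "V / 2 \<le> (sign_covariance p s t)\<^sup>2" by auto
    then have "(\<epsilon> / real k)\<^sup>2 < \<bar>sign_covariance p s t\<bar>\<^sup>2"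
      unfolding power2_abs using V \<open>(\<epsilon> / real k)\<^sup>2 \<ge> 0\<close> by linarith
    then have "\<epsilon> / real k < \<bar>sign_covariance p s t\<bar>"
      by (rule power_less_imp_less_base) simp
    then show "z \<in> {(s, t). \<epsilon> / real k < \<bar>sign_covariance p s t\<bar>}"
      using z by simp
  qed auto
  finally show ?thesis .
qed

section \<open>From group estimates to block decisions\<close>

text \<open>The index \<open>a\<close> is a pair of a block and a role: 0 and 1 for the two signs,
  any other value (in practice 2) for their product.\<close>

definition score :: "(nat \<Rightarrow> (nat \<Rightarrow> bool) \<times> (nat \<Rightarrow> bool)) \<Rightarrow> nat \<times> nat \<Rightarrow> nat \<times> nat \<Rightarrow> real" where
  "score w a x =
     (if snd a = 0 then sign_of (fst (w (fst a)) (fst x))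
      else if snd a = 1 then sign_of (snd (w (fst a)) (snd x))
      else sign_of (fst (w (fst a)) (fst x)) * sign_of (snd (w (fst a)) (snd x)))"

lemma abs_score_le_1: "\<bar>score w a x\<bar> \<le> 1"
  by (simp add: score_def abs_mult)

text \<open>The threshold \<open>4 * \<eta>\<close> is the worst error of a covariance estimate
  built from three estimates accurate to \<open>\<eta>\<close>.\<close>

definition rejecting_blocks :: "nat \<Rightarrow> real \<Rightarrow> (nat \<times> nat \<Rightarrow> real) \<Rightarrow> nat set" where
  "rejecting_blocks m \<eta> e = {j. j < m \<and> 4 * \<eta> < \<bar>e (j, 2) - e (j, 0) * e (j, 1)\<bar>}"

text \<open>If all three estimates of a block are accurate, its covariance estimate is off by at
  most \<open>4 * \<eta>\<close>: covariance 0 cannot reject and one above \<open>8 * \<eta>\<close>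
  must. So each misjudged block is charged to an inaccurate estimate of its own.\<close>

lemma rejecting_blocks_bounds:
  fixes w :: "nat \<Rightarrow> (nat \<Rightarrow> bool) \<times> (nat \<Rightarrow> bool)" and p :: "(nat \<times> nat) pmf"
    and m :: nat and \<eta> :: real
  defines "cov \<equiv> \<lambda>j. sign_covariance p (fst (w j)) (snd (w j))"
  defines "inaccurate \<equiv> \<lambda>e. {a\<in>{..<m} \<times> {..<3}. \<eta> \<le> \<bar>e a - measure_pmf.expectation p (score w a)\<bar>}"
  assumes "\<eta> \<le> 1"
  shows "(\<And>j. j < m \<Longrightarrow> cov j = 0) \<Longrightarrow> card (rejecting_blocks m \<eta> e) \<le> card (inaccurate e)"
    and "card {j. j < m \<and> 8 * \<eta> < \<bar>cov j\<bar>} \<le> card (rejecting_blocks m \<eta> e) + card (inaccurate e)"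
proof -
  have fin: "finite (inaccurate e)"
    unfolding inaccurate_def by simp
  have close: "\<bar>(e (j, 2) - e (j, 0) * e (j, 1)) - cov j\<bar> \<le> 4 * \<eta>"
    if "j < m" "j \<notin> fst ` inaccurate e" for j
  proof -
    have "\<bar>e (j, r) - measure_pmf.expectation p (score w (j, r))\<bar> < \<eta>" if "r < 3" for r
    proof -
      have "(j, r) \<notin> inaccurate e"
        using \<open>j \<notin> fst ` inaccurate e\<close> by force
      then show ?thesis
        using \<open>j < m\<close> that by (simp add: inaccurate_def)
    qed
    note err = this[of 0] this[of 1] this[of 2]
    have "score w (j, 0) = (\<lambda>x. sign_of (fst (w j) (fst x)))"
      "score w (j, 1) = (\<lambda>x. sign_of (snd (w j) (snd x)))"
      "score w (j, 2) = (\<lambda>x. sign_of (fst (w j) (fst x)) * sign_of (snd (w j) (snd x)))"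
      by (simp_all add: score_def fun_eq_iff)
    note err' = err[unfolded this, simplified]
    show ?thesis
      unfolding cov_def sign_covariance_def
      by (rule product_estimate_error)
         (use err' assms(3) in \<open>simp_all add: expectation_pmf_abs_le_1\<close>)
  qed
  have card_fst: "card (fst ` inaccurate e) \<le> card (inaccurate e)"
    using fin by (rule card_image_le)
  show "card (rejecting_blocks m \<eta> e) \<le> card (inaccurate e)" if "\<And>j. j < m \<Longrightarrow> cov j = 0"
  proof -
    have "rejecting_blocks m \<eta> e \<subseteq> fst ` inaccurate e"
    proof
      fix j assume "j \<in> rejecting_blocks m \<eta> e"
      then show "j \<in> fst ` inaccurate e"
        using close[of j] that[of j] by (cases "j \<in> fst ` inaccurate e") (auto simp: rejecting_blocks_def)
    qed
    from card_mono[OF finite_imageI[OF fin] this] card_fst show ?thesis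
      by (rule order_trans)
  qed
  have "{j. j < m \<and> 8 * \<eta> < \<bar>cov j\<bar>} \<subseteq> rejecting_blocks m \<eta> e \<union> fst ` inaccurate e"
  proof
    fix j assume j: "j \<in> {j. j < m \<and> 8 * \<eta> < \<bar>cov j\<bar>}"
    show "j \<in> rejecting_blocks m \<eta> e \<union> fst ` inaccurate e"
    proof (cases "j \<in> fst ` inaccurate e")
      case False
      with j have "\<bar>(e (j, 2) - e (j, 0) * e (j, 1)) - cov j\<bar> \<le> 4 * \<eta>" "8 * \<eta> < \<bar>cov j\<bar>"
        using close[of j] by simp_all
      then have "4 * \<eta> < \<bar>e (j, 2) - e (j, 0) * e (j, 1)\<bar>" by linarith
      with j show ?thesis by (auto simp: rejecting_blocks_def)
    qed auto
  qed
  moreover have "finite (rejecting_blocks m \<eta> e)"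
    by (simp add: rejecting_blocks_def)
  ultimately have "card {j. j < m \<and> 8 * \<eta> < \<bar>cov j\<bar>} \<le> card (rejecting_blocks m \<eta> e \<union> fst ` inaccurate e)"
    using fin by (intro card_mono) auto
  also have "\<dots> \<le> card (rejecting_blocks m \<eta> e) + card (fst ` inaccurate e)"
    by (rule card_Un_le)
  finally show "card {j. j < m \<and> 8 * \<eta> < \<bar>cov j\<bar>} \<le> card (rejecting_blocks m \<eta> e) + card (inaccurate e)"
    using card_fst by simp
qed

text \<open>The expected number of successes is at least \<open>m / 36\<close>, so this is a
  deviation of at least \<open>m / 72\<close>; Hoeffding's exponent is
  \<open>(m / 72)\<^sup>2 / (2 * m)\<close>.\<close>

lemma few_successes_Pi_pmf:
  fixes Q :: "'a pmf"
  assumes m: "m > 0" and Q: "measure_pmf.prob Q S \<ge> 1 / 36"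
  shows "measure_pmf.prob (Pi_pmf {..<m} d (\<lambda>_. Q)) {w. real (card {j. j < m \<and> w j \<in> S}) \<le> real m / 72}
    \<le> exp (- (real m / 10368))"
proof -
  let ?\<pi> = "measure_pmf.prob Q S"
  define f where "f z = ?\<pi> - indicat_real S z" for z
  have "\<bar>f z\<bar> \<le> 1" for z
    using measure_pmf.prob_le_1[of Q S] measure_nonneg[of Q S] by (auto simp: f_def indicator_def)
  moreover have "measure_pmf.expectation Q f = 0"
    by (simp add: f_def[abs_def] Bochner_Integration.integral_diff)
  ultimately have H: "measure_pmf.prob (Pi_pmf {..<m} d (\<lambda>_. Q)) {w. real m / 72 \<le> (\<Sum>j\<in>{..<m}. f (w j))}
      \<le> exp (- ((real m / 72)\<^sup>2 / (2 * real (card {..<m}))))"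
    using m by (intro Hoeffding_Pi_pmf) (auto simp: lessThan_empty_iff)
  have sum_f: "(\<Sum>j\<in>{..<m}. f (w j)) = real m * ?\<pi> - real (card {j. j < m \<and> w j \<in> S})" for w
  proof -
    have "(\<Sum>j\<in>{..<m}. indicat_real S (w j)) = real (card ({..<m} \<inter> {j. w j \<in> S}))"
      by (simp add: indicator_def sum.If_cases)
    then show ?thesis
      by (simp add: f_def sum_subtractf Int_def)
  qed
  have "measure_pmf.prob (Pi_pmf {..<m} d (\<lambda>_. Q)) {w. real (card {j. j < m \<and> w j \<in> S}) \<le> real m / 72}
      \<le> measure_pmf.prob (Pi_pmf {..<m} d (\<lambda>_. Q)) {w. real m / 72 \<le> (\<Sum>j\<in>{..<m}. f (w j))}"
  proof (intro measure_pmf.finite_measure_mono subsetI)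
    fix w assume "w \<in> {w. real (card {j. j < m \<and> w j \<in> S}) \<le> real m / 72}"
    moreover have "real m * (1 / 36) \<le> real m * ?\<pi>"
      using Q by (intro mult_left_mono) auto
    ultimately show "w \<in> {w. real m / 72 \<le> (\<Sum>j\<in>{..<m}. f (w j))}"
      by (simp add: sum_f)
  qed auto
  also note H
  also have "(real m / 72)\<^sup>2 / (2 * real (card {..<m})) = real m / 10368"
    using m by (simp add: power2_eq_square)
  finally show ?thesis .
qed

section \<open>The tester and its error probabilities\<close>

lemma ex_blockwise_tester:
  assumes k: "k \<ge> 1" and \<rho>: "0 < \<rho>" "\<rho> \<le> 1" and \<epsilon>: "0 < \<epsilon>" "\<epsilon> \<le> 1"
    and m: "m > 0" and n: "3 * m * g \<le> n"
    and g: "6 * 144\<^sup>2 * 384 * 64 * (real k ^ 2 / (\<epsilon> ^ 2 * \<rho> ^ 2)) \<le> real g"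
  obtains P :: "(real, real, bool) protocol" where
    "public_coin_LDP_protocol n k \<rho> P"
    "\<And>p. decision_prob n P p True + decision_prob n P p False = 1"
    "\<And>p. set_pmf p \<subseteq> grid k \<Longrightarrow> p = pair_pmf (map_pmf fst p) (map_pmf snd p) \<Longrightarrow>
       decision_prob n P p False \<le> exp (- real m)"
    "\<And>p. set_pmf p \<subseteq> grid k \<Longrightarrow> dTV k p (pair_pmf (map_pmf fst p) (map_pmf snd p)) > \<epsilon> \<Longrightarrow>
       decision_prob n P p True \<le> exp (- (real m / 10368)) + exp (- real m)"
proof -
  \<comment> \<open>Chosen so that \<open>8 * \<eta>\<close> is the covariance level
    \<open>\<epsilon> / k\<close> reached under dependence.\<close>
  define \<eta> where "\<eta> = \<epsilon> / (8 * real k)"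
  have \<eta>: "0 < \<eta>" "\<eta> \<le> 1"
    using k \<epsilon> by (auto simp: \<eta>_def field_simps)
  have "0 < 6 * 144\<^sup>2 * 384 * 64 * (real k ^ 2 / (\<epsilon> ^ 2 * \<rho> ^ 2))"
    using k \<epsilon> \<rho> by simp
  with g have g0: "g > 0" by linarith
  define G :: "(nat \<times> nat) set" where "G = {..<m} \<times> {..<3}"
  have G: "finite G" "card G = 3 * m"
    by (simp_all add: G_def)
  obtain I grp where I: "I \<subseteq> {1..n}" "grp ` I \<subseteq> G" "card I = card G * g"
    and cg: "\<And>a. a \<in> G \<Longrightarrow> card {i. i \<in> I \<and> grp i = a} = g"
    using ex_grouping[OF G(1), of g n] n G by auto
  have I0: "I \<noteq> {}"
    using I(3) G g0 m by auto
  define Q1 where "Q1 = pair_pmf (random_signs {1..k}) (random_signs {1..k})"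
  define Q where "Q = Pi_pmf {..<m} undefined (\<lambda>_. Q1)"
  define ch where "ch i w x = noisy_bit \<rho> (if i \<in> I then score w (grp i) x else 0)" for i w x
  \<comment> \<open>Dependence makes about \<open>m / 36\<close> covariances large, hence at least \<open>m / 72\<close> with high
    probability, while at most \<open>m / 144\<close> blocks are misjudged; the threshold separates the two.\<close>
  define ok where "ok ys \<longleftrightarrow> real (card (rejecting_blocks m \<eta> (estimate \<rho> g I grp ys))) < real m / 144" for ys
  have "LDP \<rho> (grid k) (ch i w)" for i w
    unfolding ch_def[abs_def] using \<rho> by (intro LDP_noisy_bit) (auto simp: abs_score_le_1)
  then obtain P :: "(real, real, bool) protocol" where
    P: "public_coin_LDP_protocol n k \<rho> P"
    and dp: "\<And>p b. decision_prob n P p b =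
       pmf (Q \<bind> (\<lambda>w. Pi_pmf {1..n} undefined (\<lambda>i. p \<bind> ch i w) \<bind> (\<lambda>ys. return_pmf (ok ys)))) b"
    using obtain_shared_coin_protocol[of \<rho> k ch n Q "\<lambda>_ ys. return_pmf (ok ys)"] by metis
  define Y where "Y p w = Pi_pmf {1..n} undefined (\<lambda>i. p \<bind> ch i w)" for p w
  have dp': "decision_prob n P p b = (\<integral>w. measure_pmf.prob (Y p w) {ys. ok ys = b} \<partial>Q)" for p b
    unfolding dp Y_def[symmetric]
    by (simp add: pmf_bind map_pmf_def[symmetric] pmf_map vimage_def)
  have int: "integrable (measure_pmf Q) (\<lambda>w. measure_pmf.prob (Y p w) (E w))" for p E
    by (intro integrable_pmf_bounded) simp
  define inacc where "inacc p w ys =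
    {a\<in>{..<m} \<times> {..<3}. \<eta> \<le> \<bar>estimate \<rho> g I grp ys a - measure_pmf.expectation p (score w a)\<bar>}" for p w ys
  \<comment> \<open>The bound holds for every fixed outcome \<open>w\<close> of the shared coin, so
    it survives integration over \<open>Q\<close>.\<close>
  have acc: "measure_pmf.prob (Y p w) {ys. real m / 144 \<le> real (card (inacc p w ys))} \<le> exp (- real m)" for p w
  proof -
    have "measure_pmf.prob (Y p w) {ys. real m / 144 \<le> real (card (inacc p w ys))}
        \<le> 3 ^ card G * exp (- ((real m / 144 * (real g * \<rho> * \<eta> / 8))\<^sup>2 / (2 * real (card I))))"
      unfolding Y_def ch_def[abs_def] inacc_def G_def[symmetric]
      using \<rho> \<eta> g0 I0 by (intro many_inaccurate_estimates I(1,2) G cg abs_score_le_1) auto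
    \<comment> \<open>Here \<open>card I = 3 * m * g\<close>; the factor \<open>384 * 64\<close> is
      \<open>6 * 8\<^sup>2 * 8\<^sup>2\<close>, from \<open>2 * card I\<close>, the scale of the
      randomized response and the 8 in \<open>\<eta>\<close>.\<close>
    also have "(real m / 144 * (real g * \<rho> * \<eta> / 8))\<^sup>2 / (2 * real (card I)) =
        real m * (real g * (\<epsilon>\<^sup>2 * \<rho>\<^sup>2) / (144\<^sup>2 * 384 * 64 * (real k)\<^sup>2))"
      using m g0 k by (simp add: I(3) G \<eta>_def power2_eq_square field_simps)
    \<comment> \<open>The lower bound on \<open>g\<close> makes the exponent beat the \<open>27 ^ m\<close> weightings of the groups.\<close>
    also have "3 ^ card G * exp (- (real m * (real g * (\<epsilon>\<^sup>2 * \<rho>\<^sup>2) / (144\<^sup>2 * 384 * 64 * (real k)\<^sup>2))))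
        \<le> exp (5 * real m) * exp (- (real m * 6))"
    proof (intro mult_mono)
      have "(3::real) ^ card G = 27 ^ m"
        by (simp add: G power_mult)
      also have "\<dots> \<le> (exp 1 ^ 5) ^ m"
      proof (rule power_mono)
        have "(2::real) ^ 5 \<le> exp 1 ^ 5"
          using exp_ge_add_one_self[of 1] by (intro power_mono) auto
        then show "(27::real) \<le> exp 1 ^ 5" by simp
      qed simp
      also have "\<dots> = exp (5 * real m)"
        by (simp add: exp_of_nat_mult[symmetric] power_mult[symmetric])
      finally show "3 ^ card G \<le> exp (5 * real m)" .
      have "6 \<le> real g * (\<epsilon>\<^sup>2 * \<rho>\<^sup>2) / (144\<^sup>2 * 384 * 64 * (real k)\<^sup>2)"
        using g k \<epsilon> \<rho> by (simp add: field_simps)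
      then show "exp (- (real m * (real g * (\<epsilon>\<^sup>2 * \<rho>\<^sup>2) / (144\<^sup>2 * 384 * 64 * (real k)\<^sup>2)))) \<le> exp (- (real m * 6))"
        by (simp only: exp_le_cancel_iff neg_le_iff_le) (intro mult_left_mono, auto)
    qed auto
    also have "\<dots> = exp (- real m)"
      by (simp flip: exp_add)
    finally show ?thesis .
  qed
  show ?thesis
  proof (rule that[OF P])
    fix p
    have "measure_pmf.prob (Y p w) {ys. ok ys = True} + measure_pmf.prob (Y p w) {ys. ok ys = False} = 1" for w
    proof -
      have "{ys. ok ys = False} = space (Y p w) - {ys. ok ys = True}"
        by auto
      then show ?thesis
        using measure_pmf.prob_compl[of "{ys. ok ys = True}" "Y p w"] by simp
    qed
    then have "decision_prob n P p True + decision_prob n P p False = (\<integral>w. 1 \<partial>Q)"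
      unfolding dp' by (subst Bochner_Integration.integral_add[OF int int, symmetric]) (simp only:)
    then show "decision_prob n P p True + decision_prob n P p False = 1"
      by simp
  next
    fix p assume p: "set_pmf p \<subseteq> grid k" "p = pair_pmf (map_pmf fst p) (map_pmf snd p)"
    have fin: "finite (set_pmf p)"
      using p(1) by (rule finite_subset) (simp add: grid_def)
    have cov0: "sign_covariance p s t = 0" for s t
      unfolding sign_covariance_eq[OF fin] by (subst (1) p(2)) (rule right_minus_eq[THEN iffD2, OF refl])
    have "measure_pmf.prob (Y p w) {ys. ok ys = False} \<le> exp (- real m)" for w
    proof -
      have "measure_pmf.prob (Y p w) {ys. ok ys = False} \<le>
          measure_pmf.prob (Y p w) {ys. real m / 144 \<le> real (card (inacc p w ys))}"
      proof (intro measure_pmf.finite_measure_mono subsetI)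
        fix ys assume "ys \<in> {ys. ok ys = False}"
        moreover have "card (rejecting_blocks m \<eta> (estimate \<rho> g I grp ys)) \<le> card (inacc p w ys)"
          unfolding inacc_def by (rule rejecting_blocks_bounds(1)[OF \<eta>(2)]) (rule cov0)
        ultimately show "ys \<in> {ys. real m / 144 \<le> real (card (inacc p w ys))}"
          by (auto simp: ok_def)
      qed auto
      also note acc
      finally show ?thesis .
    qed
    then show "decision_prob n P p False \<le> exp (- real m)"
      unfolding dp' by (intro measure_pmf.integral_le_const int) auto
  next
    fix p assume p: "set_pmf p \<subseteq> grid k" "dTV k p (pair_pmf (map_pmf fst p) (map_pmf snd p)) > \<epsilon>"
    define S where "S = {(s, t). \<epsilon> / real k < \<bar>sign_covariance p s t\<bar>}"
    define W where "W = {w. real (card {j. j < m \<and> w j \<in> S}) \<le> real m / 72}"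
    have W: "measure_pmf.prob Q W \<le> exp (- (real m / 10368))"
      unfolding Q_def W_def Q1_def S_def
      by (intro few_successes_Pi_pmf m sign_covariance_detects_dependence p k \<epsilon>)
    \<comment> \<open>\<open>W\<close> collects the unlucky coins. Off \<open>W\<close> more than
      \<open>m / 72\<close> covariances are large; acceptance means fewer than
      \<open>m / 144\<close> blocks reject, so more than \<open>m / 144\<close> estimates are
      inaccurate.\<close>
    have "measure_pmf.prob (Y p w) {ys. ok ys = True} \<le> indicat_real W w + exp (- real m)" for w
    proof (cases "w \<in> W")
      case True
      then show ?thesis
        using measure_pmf.prob_le_1[of "Y p w" "{ys. ok ys = True}"] by (simp add: add_increasing2)
    next
      case False
      have "measure_pmf.prob (Y p w) {ys. ok ys = True} \<le>
          measure_pmf.prob (Y p w) {ys. real m / 144 \<le> real (card (inacc p w ys))}"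
      proof (intro measure_pmf.finite_measure_mono subsetI)
        fix ys assume "ys \<in> {ys. ok ys = True}"
        moreover have "card {j. j < m \<and> 8 * \<eta> < \<bar>sign_covariance p (fst (w j)) (snd (w j))\<bar>}
            \<le> card (rejecting_blocks m \<eta> (estimate \<rho> g I grp ys)) + card (inacc p w ys)"
          unfolding inacc_def by (rule rejecting_blocks_bounds(2)[OF \<eta>(2)])
        moreover have "{j. j < m \<and> 8 * \<eta> < \<bar>sign_covariance p (fst (w j)) (snd (w j))\<bar>} = {j. j < m \<and> w j \<in> S}"
          by (auto simp: S_def \<eta>_def case_prod_unfold)
        ultimately show "ys \<in> {ys. real m / 144 \<le> real (card (inacc p w ys))}"
          using False by (auto simp: ok_def W_def)
      qed auto
      also note acc
      finally show ?thesis using False by simp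
    qed
    then have "decision_prob n P p True \<le> (\<integral>w. indicat_real W w + exp (- real m) \<partial>Q)"
      unfolding dp'
      by (intro integral_mono int Bochner_Integration.integrable_add) auto
    also have "\<dots> = measure_pmf.prob Q W + exp (- real m)"
      by simp
    finally show "decision_prob n P p True \<le> exp (- (real m / 10368)) + exp (- real m)"
      using W by simp
  qed
qed

text \<open>The marginals of \<open>p\<close> compete in the infimum, which is bounded below by
  0.\<close>

lemma dTV_marginals_gt:
  assumes p: "set_pmf p \<subseteq> grid k"
    and INF: "(INF (q1, q2)\<in>{q. set_pmf q \<subseteq> {1..k}} \<times> {q. set_pmf q \<subseteq> {1..k}}.
            dTV k p (pair_pmf q1 q2)) > \<epsilon>"
  shows "dTV k p (pair_pmf (map_pmf fst p) (map_pmf snd p)) > \<epsilon>"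
proof -
  have "(INF z\<in>{q. set_pmf q \<subseteq> {1..k}} \<times> {q. set_pmf q \<subseteq> {1..k}}. case z of (q1, q2) \<Rightarrow>
      dTV k p (pair_pmf q1 q2)) \<le> (case (map_pmf fst p, map_pmf snd p) of (q1, q2) \<Rightarrow> dTV k p (pair_pmf q1 q2))"
  proof (rule cINF_lower)
    show "bdd_below ((\<lambda>z. case z of (q1, q2) \<Rightarrow> dTV k p (pair_pmf q1 q2)) `
        ({q. set_pmf q \<subseteq> {1..k}} \<times> {q. set_pmf q \<subseteq> {1..k}}))"
      by (rule bdd_belowI[of _ 0]) (auto simp: dTV_def sum_nonneg)
  qed (use p in \<open>force simp: grid_def\<close>)
  with INF show ?thesis by simp
qed

theorem theorem8:
  shows "\<exists>C::real. C > 0 \<and>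
    (\<forall>(k::nat) (\<rho>::real) (\<epsilon>::real) (\<delta>::real).
       k \<ge> 1 \<longrightarrow> 0 < \<rho> \<longrightarrow> \<rho> \<le> 1 \<longrightarrow> 0 < \<epsilon> \<longrightarrow> \<epsilon> \<le> 1 \<longrightarrow> 0 < \<delta> \<longrightarrow> \<delta> < 1 \<longrightarrow>
       (\<exists>(n::nat) (P :: (real, real, bool) protocol).
          n = nat \<lceil>C * (real k ^ 2 / (\<epsilon> ^ 2 * \<rho> ^ 2)) * ln (1 / \<delta>)\<rceil> \<and>
          public_coin_LDP_protocol n k \<rho> P \<and>
          solves_independence_testing n k \<epsilon> \<delta> P))"
proof -
  define A :: real where "A = 6 * 144\<^sup>2 * 384 * 64"
  \<comment> \<open>Three groups per block, at most \<open>31106 * l\<close> blocks and at most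
    \<open>(A + 1) * R\<close> players per group, with \<open>l\<close> and \<open>R\<close> as
    defined below.\<close>
  define C :: real where "C = 3 * 31106 * (A + 1)"
  have A0: "A > 0" by (simp add: A_def)
  have "\<exists>P :: (real, real, bool) protocol. public_coin_LDP_protocol n k \<rho> P \<and> solves_independence_testing n k \<epsilon> \<delta> P"
    if k: "k \<ge> 1" and \<rho>: "0 < \<rho>" "\<rho> \<le> 1" and \<epsilon>: "0 < \<epsilon>" "\<epsilon> \<le> 1" and \<delta>: "0 < \<delta>" "\<delta> < 1"
      and n: "n = nat \<lceil>C * (real k ^ 2 / (\<epsilon> ^ 2 * \<rho> ^ 2)) * ln (1 / \<delta>)\<rceil>" for n k \<rho> \<epsilon> \<delta>
  proof (cases "\<delta> \<le> 1 / 2")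
    case False
    \<comment> \<open>For such \<open>\<delta>\<close> the prescribed \<open>n\<close> may be too small for the test, but a fair coin already suffices.\<close>
    have "LDP \<rho> (grid k) (\<lambda>_. return_pmf True)"
      using \<rho> by (auto simp: LDP_def indicator_def)
    then obtain P :: "(real, real, bool) protocol" where
      P: "public_coin_LDP_protocol n k \<rho> P"
      and dp: "\<And>p b. decision_prob n P p b =
         pmf (return_pmf () \<bind> (\<lambda>w. Pi_pmf {1..n} undefined (\<lambda>i. p \<bind> (\<lambda>_. return_pmf True)) \<bind>
           (\<lambda>ys. bernoulli_pmf (1 / 2)))) b"
      using obtain_shared_coin_protocol[of \<rho> k "\<lambda>_ _ _. return_pmf True" n "return_pmf ()"
          "\<lambda>_ _. bernoulli_pmf (1 / 2)"] by metis
    have half: "decision_prob n P p b = 1 / 2" for p b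
      unfolding dp by (cases b) simp_all
    have "solves_independence_testing n k \<epsilon> \<delta> P"
      unfolding solves_independence_testing_def half using False by auto
    with P show ?thesis by blast
  next
    case True
    define R where "R = real k ^ 2 / (\<epsilon> ^ 2 * \<rho> ^ 2)"
    define l where "l = ln (1 / \<delta>)"
    \<comment> \<open>\<open>31104 = 3 * 10368\<close> turns the coin's failure bound into
      \<open>\<delta> ^ 3\<close>. Rounding up costs at most \<open>2 * l\<close>, because
      \<open>l \<ge> 1 / 2\<close>.\<close>
    define m where "m = nat \<lceil>31104 * l\<rceil>"
    define g where "g = nat \<lceil>A * R\<rceil>"
    have "exp (1 / 2 :: real) \<le> 2"
    proof -
      have "exp (1 / 2 :: real) \<le> 1 + 1 / 2 + (1 / 2)\<^sup>2"
        by (rule exp_bound) auto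
      then show ?thesis by (simp add: power2_eq_square)
    qed
    then have "1 / 2 \<le> ln (2 :: real)"
      by (subst ln_ge_iff) auto
    also have "ln 2 \<le> l"
      unfolding l_def using \<delta> True by (subst ln_le_cancel_iff) (auto simp: field_simps)
    finally have l: "1 / 2 \<le> l" .
    have "\<epsilon> ^ 2 * \<rho> ^ 2 \<le> 1 * 1"
      using \<epsilon> \<rho> by (intro mult_mono power_le_one) auto
    moreover have "1 \<le> real k ^ 2"
      using k by simp
    ultimately have R: "R \<ge> 1"
      using \<epsilon> \<rho> unfolding R_def by (subst le_divide_eq_1_pos) auto
    have m_ge: "31104 * l \<le> real m" and m_le: "real m \<le> 31106 * l"
      using l unfolding m_def by linarith+
    have "0 \<le> A * R" using A0 R by simp
    then have g_ge: "A * R \<le> real g" and "real g \<le> A * R + 1"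
      unfolding g_def by linarith+
    then have g_le: "real g \<le> (A + 1) * R"
      using R by (simp add: algebra_simps)
    have m0: "m > 0" using m_ge l by (intro gr0I) auto
    have "real (3 * m * g) \<le> 3 * (31106 * l) * ((A + 1) * R)"
      using m_le g_le l by (simp only: of_nat_mult of_nat_numeral) (intro mult_mono, auto)
    also have "\<dots> = C * R * l"
      by (simp add: C_def)
    finally have "3 * m * g \<le> n"
      unfolding n R_def[symmetric] l_def[symmetric] by linarith
    from k \<rho> \<epsilon> m0 this g_ge[unfolded A_def R_def] obtain P :: "(real, real, bool) protocol" where
      P: "public_coin_LDP_protocol n k \<rho> P"
      and compl: "\<And>p. decision_prob n P p True + decision_prob n P p False = 1"
      and null: "\<And>p. set_pmf p \<subseteq> grid k \<Longrightarrow> p = pair_pmf (map_pmf fst p) (map_pmf snd p) \<Longrightarrow>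
       decision_prob n P p False \<le> exp (- real m)"
      and alt: "\<And>p. set_pmf p \<subseteq> grid k \<Longrightarrow> dTV k p (pair_pmf (map_pmf fst p) (map_pmf snd p)) > \<epsilon> \<Longrightarrow>
       decision_prob n P p True \<le> exp (- (real m / 10368)) + exp (- real m)"
      by (rule ex_blockwise_tester) blast
    have "exp (- (real m / 10368)) \<le> exp (- (3 * l))"
      using m_ge by simp
    also have "\<dots> = \<delta> ^ 3"
      using \<delta> by (simp add: l_def ln_div exp_of_nat_mult[of 3, simplified])
    \<comment> \<open>With \<open>\<delta> \<le> 1 / 2\<close> each exponential is at most
      \<open>\<delta> / 4\<close>, so even their sum stays below \<open>\<delta>\<close>.\<close>
    also have "\<dots> \<le> \<delta> * (1 / 2)\<^sup>2"
      using \<delta> True unfolding power3_eq_cube power2_eq_square mult.assoc by (intro mult_mono) auto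
    finally have e1: "exp (- (real m / 10368)) \<le> \<delta> / 4"
      by (simp add: power2_eq_square)
    have e2: "exp (- real m) \<le> exp (- (real m / 10368))"
      by simp
    have "decision_prob n P p True > 1 - \<delta>"
      if "set_pmf p \<subseteq> grid k" "p = pair_pmf (map_pmf fst p) (map_pmf snd p)" for p
      using null[OF that] compl[of p] e1 e2 \<delta> by linarith
    moreover have "decision_prob n P p False > 1 - \<delta>"
      if "set_pmf p \<subseteq> grid k" "(INF (q1, q2)\<in>{q. set_pmf q \<subseteq> {1..k}} \<times> {q. set_pmf q \<subseteq> {1..k}}.
            dTV k p (pair_pmf q1 q2)) > \<epsilon>" for p
      using alt[OF that(1) dTV_marginals_gt[OF that]] compl[of p] e1 e2 \<delta> by linarith
    ultimately show ?thesis
      using P by (auto simp: solves_independence_testing_def)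
  qed
  note main = this
  show ?thesis
  proof (rule exI[of _ C], intro conjI allI impI, goal_cases)
    case 1
    show ?case using A0 by (simp add: C_def)
  next
    case (2 k \<rho> \<epsilon> \<delta>)
    from main[OF this refl] show ?case by blast
  qed
qed

end
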